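(* A subset $\mathcal{P}$ of $\mathbb{R}_{\max}^n$ is a tropical polyhedron with mixed constraints if, and only if, $\mathcal{P}$ is tropically convex and is a union of finitely many zones of $\mathbb{R}_{\max}^n$.
   Context: $\mathbb{R}_{\max}=\mathbb{R}\cup\{-\infty\}$ is the max-plus semiring ($x\oplus y=\max(x,y)$, $x\otimes y=xy=x+y$), and $\overline{\mathbb{R}}_{\max}=\mathbb{R}_{\max}\cup\{+\infty\}$. Let $\mathbb{R}^-=\{\alpha^-:\alpha\in\mathbb{R}\}$ be a disjoint copy of $\mathbb{R}$ and $\mathbb{G}=\overline{\mathbb{R}}_{\max}\cup\mathbb{R}^-$. The modulus is $|x|=x$ for $x\in\overline{\mathbb{R}}_{\max}$ and $|\alpha^-|=\alpha$. The total order $\leq_{\mathbb{G}}$ is: $x\leq_{\mathbb{G}}y$ iff $|x|<|y|$ when $x\in\overline{\mathbb{R}}_{\max}$ and $y\in\mathbb{R}^-$, and $|x|\le|y|$ in all other cases. $\mathbb{G}$ is a semiring where $x\oplus y$ is the greater of $x,y$ for $\leq_{\mathbb{G}}$, and $xy$ is: $x+y$ if $x,y\in\mathbb{R}$; $(|x|+|y|)^-$ if $x\in\mathbb{R}^-$ or $y\in\mathbb{R}^-$ and both are different from $\pm\infty$; $-\infty$ if $x=-\infty$ or $y=-\infty$; $+\infty$ if neither is $-\infty$ and at least one is $+\infty$. A mixed tropical affine inequality is a constraint $a_0\oplus a_1\mathbf{x}_1\oplus\cdots\oplus a_n\mathbf{x}_n\leq_{\mathbb{G}}b_0\oplus b_1\mathbf{x}_1\oplus\cdots\oplus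 b_n\mathbf{x}_n$ with $a_i\in\mathbb{R}_{\max}$ and $b_i\in\mathbb{G}$. A tropical polyhedron with mixed constraints is the set of $\mathbf{x}\in\mathbb{R}_{\max}^n$ satisfying finitely many mixed tropical affine inequalities. A subset $\mathcal{C}\subset\mathbb{R}_{\max}^n$ is tropically convex if $\lambda\mathbf{x}\oplus\mu\mathbf{y}\in\mathcal{C}$ for all $\mathbf{x},\mathbf{y}\in\mathcal{C}$ and $\lambda,\mu\in\mathbb{R}_{\max}$ with $\lambda\oplus\mu=0$. A zone of $\mathbb{R}_{\max}^n$ is a set of vectors $\mathbf{x}\in\mathbb{R}_{\max}^n$ defined by finitely many inequalities of the forms $m_i\lhd\mathbf{x}_i$, $\mathbf{x}_i\lhd M_i$, $\mathbf{x}_i\lhd k_{ij}\mathbf{x}_j$ (i.e. $k_{ij}+\mathbf{x}_j$), where each $\lhd$ is $\leq$ or $<$ and $m_i,M_i,k_{ij}\in\mathbb{R}_{\max}$. *)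

theory Defs
  imports "HOL-Library.Extended_Real" "Jordan_Normal_Form.Matrix"
begin

section \<open>The semiring \<open>\<G>\<close>\<close>

text \<open>
  \<open>Plain x\<close> is the element \<open>x\<close> of the completed max-plus semiring
  (\<open>ereal\<close> is the set of reals with both infinities), and \<open>Minus \<alpha>\<close> is the copy
  \<open>\<alpha>\<^sup>-\<close> of the real number \<open>\<alpha>\<close>.
\<close>

datatype G = Plain ereal | Minus real

fun modulus :: "G \<Rightarrow> ereal" where
  "modulus (Plain x) = x"
| "modulus (Minus a) = ereal a"

lemma G_cases [case_names MInf PInf Real Minus]:
  obtains "x = Plain (-\<infinity>)" | "x = Plain \<infinity>" | a where "x = Plain (ereal a)" | a where "x = Minus a"
  by (metis G.exhaust ereal_cases)

lemma range_Plain_Minus [simp]: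
  "Plain x \<notin> range Minus" "Minus a \<notin> range Plain"
  by auto

text \<open>
  The type-class operations on \<^typ>\<open>G\<close> are the tropical ones: \<open>+\<close> is the maximum for the
  order of \<open>\<G>\<close>, \<open>*\<close> adds moduli, \<open>0\<close> is \<open>-\<infinity>\<close> and \<open>1\<close> is the real number zero.
\<close>

instantiation G :: linorder
begin

definition less_eq_G :: "G \<Rightarrow> G \<Rightarrow> bool" where
  "x \<le> y \<longleftrightarrow>
    (if x \<in> range Plain \<and> y \<in> range Minus then modulus x < modulus y
     else modulus x \<le> modulus y)"

definition less_G :: "G \<Rightarrow> G \<Rightarrow> bool" where
  "x < y \<longleftrightarrow> x \<le> y \<and> \<not> y \<le> (x :: G)"

lemma less_eq_G_simps [simp]:
  "Plain x \<le> Plain y \<longleftrightarrow> x \<le> y"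
  "Plain x \<le> Minus b \<longleftrightarrow> x < ereal b"
  "Minus a \<le> Plain y \<longleftrightarrow> ereal a \<le> y"
  "Minus a \<le> Minus b \<longleftrightarrow> a \<le> b"
  by (simp_all add: less_eq_G_def)

instance
proof
  fix x y z :: G
  show "x < y \<longleftrightarrow> x \<le> y \<and> \<not> y \<le> x" by (simp add: less_G_def)
  show "x \<le> x" by (cases x) simp_all
  show "x \<le> z" if "x \<le> y" "y \<le> z"
    using that
    by (cases x rule: G_cases; cases y rule: G_cases; cases z rule: G_cases) auto
  show "x = y" if "x \<le> y" "y \<le> x"
    using that by (cases x rule: G_cases; cases y rule: G_cases) auto
  show "x \<le> y \<or> y \<le> x"
    by (cases x rule: G_cases; cases y rule: G_cases) auto
qed

end

instantiation G :: comm_semiring_1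
begin

definition zero_G :: G where "0 = Plain (-\<infinity>)"

definition one_G :: G where "1 = Plain 0"

definition plus_G :: "G \<Rightarrow> G \<Rightarrow> G" where "x + y = max x (y :: G)"

definition times_G :: "G \<Rightarrow> G \<Rightarrow> G" where
  "x * y =
    (if x = Plain (-\<infinity>) \<or> y = Plain (-\<infinity>) then Plain (-\<infinity>)
     else if x = Plain \<infinity> \<or> y = Plain \<infinity> then Plain \<infinity>
     else if x \<in> range Minus \<or> y \<in> range Minus
       then Minus (real_of_ereal (modulus x + modulus y))
     else Plain (modulus x + modulus y))"

lemma times_G_mono: "x \<le> y \<Longrightarrow> x * z \<le> y * (z :: G)"
  by (cases x rule: G_cases; cases y rule: G_cases; cases z rule: G_cases)
    (auto simp: times_G_def image_iff)

instance
proof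
  fix x y z :: G
  show "x + y + z = x + (y + z)" by (simp add: plus_G_def max.assoc)
  show "x + y = y + x" by (simp add: plus_G_def max.commute)
  show "0 + x = x"
    by (cases x) (auto simp: plus_G_def zero_G_def max_def)
  show "x * y * z = x * (y * z)"
    by (cases x rule: G_cases; cases y rule: G_cases; cases z rule: G_cases)
      (auto simp: times_G_def)
  show "x * y = y * x"
    by (auto simp: times_G_def add.commute)
  show "1 * x = x"
    by (cases x rule: G_cases) (auto simp: times_G_def one_G_def zero_ereal_def)
  show "0 * x = 0" "x * 0 = 0" by (simp_all add: times_G_def zero_G_def)
  show "(0::G) \<noteq> 1" by (simp add: zero_G_def one_G_def)
  show "(x + y) * z = x * z + y * z"
    using times_G_mono[of x y z] times_G_mono[of y x z]
    by (auto simp: plus_G_def max_def)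
qed

end

definition Rmax :: "G set" where
  "Rmax = {Plain x | x. x \<noteq> \<infinity>}"

definition Rmax_vec :: "nat \<Rightarrow> G vec set" where
  "Rmax_vec n = {x \<in> carrier_vec n. \<forall>i<n. x $ i \<in> Rmax}"


section \<open>Tropical polyhedra with mixed constraints\<close>

text \<open>
  The tuple \<open>(a0, a, b0, b)\<close> stands for the mixed affine inequality with constant terms
  \<open>a0\<close>, \<open>b0\<close> and coefficient vectors \<open>a\<close>, \<open>b\<close>.  Scalar products and the order are those
  of \<^typ>\<open>G\<close>; only the right-hand coefficients range over all of \<^typ>\<open>G\<close>.
\<close>

type_synonym mixed_ineq = "G \<times> G vec \<times> G \<times> G vec"

definition mixed_ineqs :: "nat \<Rightarrow> mixed_ineq set" where
  "mixed_ineqs n = Rmax \<times> Rmax_vec n \<times> UNIV \<times> carrier_vec n"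

definition satisfies :: "G vec \<Rightarrow> mixed_ineq \<Rightarrow> bool" where
  "satisfies x = (\<lambda>(a0, a, b0, b). a0 + a \<bullet> x \<le> b0 + b \<bullet> x)"

definition mixed_tropical_polyhedron :: "nat \<Rightarrow> G vec set \<Rightarrow> bool" where
  "mixed_tropical_polyhedron n P \<longleftrightarrow>
    (\<exists>S. finite S \<and> S \<subseteq> mixed_ineqs n \<and> P = {x \<in> Rmax_vec n. \<forall>c\<in>S. satisfies x c})"


section \<open>Tropical convexity and zones\<close>

definition tropically_convex :: "G vec set \<Rightarrow> bool" where
  "tropically_convex C \<longleftrightarrow>
    (\<forall>x\<in>C. \<forall>y\<in>C. \<forall>l\<in>Rmax. \<forall>m\<in>Rmax. l + m = 1 \<longrightarrow> l \<cdot>\<^sub>v x + m \<cdot>\<^sub>v y \<in> C)"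

text \<open>
  Inequalities of a zone are represented by the predicates they define; \<open>k * x $ j\<close> is the
  usual sum of \<open>k\<close> and the \<open>j\<close>-th entry of \<open>x\<close>.
\<close>

inductive zone_ineq :: "nat \<Rightarrow> (G vec \<Rightarrow> bool) \<Rightarrow> bool" for n where
  lower: "i < n \<Longrightarrow> m \<in> Rmax \<Longrightarrow> R \<in> {(\<le>), (<)} \<Longrightarrow> zone_ineq n (\<lambda>x. R m (x $ i))"
| upper: "i < n \<Longrightarrow> M \<in> Rmax \<Longrightarrow> R \<in> {(\<le>), (<)} \<Longrightarrow> zone_ineq n (\<lambda>x. R (x $ i) M)"
| diff: "i < n \<Longrightarrow> j < n \<Longrightarrow> k \<in> Rmax \<Longrightarrow> R \<in> {(\<le>), (<)} \<Longrightarrow>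
    zone_ineq n (\<lambda>x. R (x $ i) (k * x $ j))"

definition zone :: "nat \<Rightarrow> G vec set \<Rightarrow> bool" where
  "zone n Z \<longleftrightarrow>
    (\<exists>Q. finite Q \<and> (\<forall>q\<in>Q. zone_ineq n q) \<and> Z = {x \<in> Rmax_vec n. \<forall>q\<in>Q. q x})"

end

theory Submission
  imports Defs
begin

text \<open>
  In \<open>\<G>\<close> a sum is a maximum, so a mixed inequality between sums is a Boolean combination of
  inequalities between two monomials; this turns a polyhedron into a finite union of zones.

  Conversely, let \<open>P\<close> be a convex union of zones \<open>Z\<close>.  The set of all \<open>\<lambda> (1, x)\<close> with
  \<open>x \<in> Z\<close> is defined by homogeneous mixed inequalities, and Fourier-Motzkin elimination
  shows that so is the sum of these cones over all \<open>Z\<close>.  The cone over \<open>P\<close> contains each of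
  them and, by convexity, is closed under addition, so it equals their sum; setting the
  homogenising coordinate to \<open>1\<close> gives a description of \<open>P\<close>.
\<close>

section \<open>Arithmetic of \<open>\<G>\<close>\<close>

text \<open>The two kinds of non-invertible right-hand coefficients have distinct tasks:
  \<open>Minus b\<close> makes an inequality strict, and \<open>Plain \<infinity>\<close> says that
  one coordinate may differ from \<open>0\<close> only if another does. Elimination stays within
  this format: a variable is isolated by dividing by its left-hand coefficient, which lies in
  \<open>Rmax\<close> and is then invertible, and its upper bound is substituted into right-hand
  sides only. The obstacle is that this bound may evaluate to an element outside \<open>Rmax\<close>
  and so need not be a value of the variable; finitely many inequalities can nevertheless be met
  below it. Homogenising replaces the normalised combinations of convexity by plain sums; nothing is
  lost, because the homogenising coordinate of a point on a ray determines its scalar.\<close>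

lemma times_G_simps [simp]:
  "Plain (-\<infinity>) * y = Plain (-\<infinity>)"
  "y * Plain (-\<infinity>) = Plain (-\<infinity>)"
  "Plain \<infinity> * Plain \<infinity> = Plain \<infinity>"
  "Plain \<infinity> * Plain (ereal b) = Plain \<infinity>"
  "Plain \<infinity> * Minus b = Plain \<infinity>"
  "Plain (ereal a) * Plain \<infinity> = Plain \<infinity>"
  "Minus a * Plain \<infinity> = Plain \<infinity>"
  "Plain (ereal a) * Plain (ereal b) = Plain (ereal (a + b))"
  "Plain (ereal a) * Minus b = Minus (a + b)"
  "Minus a * Plain (ereal b) = Minus (a + b)"
  "Minus a * Minus b = Minus (a + b)"
  by (auto simp: times_G_def)

lemma less_G_simps [simp]:
  "Plain x < Plain y \<longleftrightarrow> x < y"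
  "Plain x < Minus b \<longleftrightarrow> x < ereal b"
  "Minus a < Plain y \<longleftrightarrow> ereal a \<le> y"
  "Minus a < Minus b \<longleftrightarrow> a < b"
  by (auto simp: less_G_def)

lemma zero_le_G [simp]: "0 \<le> (x :: G)"
  by (cases x rule: G_cases) (auto simp: zero_G_def)

lemma le_zero_G [simp]: "x \<le> 0 \<longleftrightarrow> x = (0 :: G)"
  by (simp add: antisym)

lemma zero_less_G [simp]: "0 < (x :: G) \<longleftrightarrow> x \<noteq> 0"
  by (metis le_zero_G not_le)

lemma le_PInf_G [simp]: "x \<le> Plain \<infinity>"
  by (cases x) auto

lemma times_PInf_G: "x \<noteq> 0 \<Longrightarrow> x * Plain \<infinity> = Plain \<infinity>" "x \<noteq> 0 \<Longrightarrow> Plain \<infinity> * x = Plain \<infinity>"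
  by (auto simp: times_G_def zero_G_def)

lemma times_G_eq_0_iff [simp]: "x * y = 0 \<longleftrightarrow> x = 0 \<or> y = (0 :: G)"
  by (cases x rule: G_cases; cases y rule: G_cases) (auto simp: zero_G_def)

lemma plus_G_le_iff [simp]: "x + y \<le> z \<longleftrightarrow> x \<le> z \<and> y \<le> (z :: G)"
  by (simp add: plus_G_def)

lemma le_plus_G_iff: "z \<le> x + y \<longleftrightarrow> z \<le> x \<or> z \<le> (y :: G)"
  by (simp add: plus_G_def le_max_iff_disj)

lemma plus_G_mono: "x \<le> x' \<Longrightarrow> y \<le> y' \<Longrightarrow> x + y \<le> x' + (y' :: G)"
  by (auto simp: le_plus_G_iff)

lemma times_G_left_mono: "x \<le> y \<Longrightarrow> z * x \<le> z * (y :: G)"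
  using times_G_mono[of x y z] by (simp add: mult.commute)

lemma sum_G_le_iff: "finite I \<Longrightarrow> sum f I \<le> y \<longleftrightarrow> (\<forall>i\<in>I. f i \<le> (y :: G))"
  by (induction rule: finite_induct) auto

lemma le_sum_G_iff:
  "finite I \<Longrightarrow> I \<noteq> {} \<Longrightarrow> y \<le> sum f I \<longleftrightarrow> (\<exists>i\<in>I. y \<le> (f i :: G))"
  by (induction rule: finite_ne_induct) (auto simp: le_plus_G_iff)

lemma Rmax_iff: "x \<in> Rmax \<longleftrightarrow> x = 0 \<or> (\<exists>a. x = Plain (ereal a))"
  by (cases x rule: G_cases) (auto simp: Rmax_def zero_G_def)

lemma Rmax_cases [consumes 1, case_names zero real]:
  assumes "x \<in> Rmax"
  obtains "x = 0" | a where "x = Plain (ereal a)"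
  using assms by (auto simp: Rmax_iff)

lemma Rmax_0 [simp]: "0 \<in> Rmax" and Rmax_1 [simp]: "1 \<in> Rmax"
  by (auto simp: Rmax_iff one_G_def zero_ereal_def)

lemma Rmax_Real [simp]: "Plain (ereal a) \<in> Rmax"
  by (auto simp: Rmax_iff)

lemma Real_neq_0 [simp]: "Plain (ereal a) \<noteq> 0"
  by (auto simp: zero_G_def)

lemma Rmax_plus [simp]: "x \<in> Rmax \<Longrightarrow> y \<in> Rmax \<Longrightarrow> x + y \<in> Rmax"
  by (auto simp: plus_G_def max_def)

lemma Rmax_times [simp]: "x \<in> Rmax \<Longrightarrow> y \<in> Rmax \<Longrightarrow> x * y \<in> Rmax"
  by (auto simp: Rmax_iff)

lemma Rmax_sum: "(\<And>i. i \<in> I \<Longrightarrow> f i \<in> Rmax) \<Longrightarrow> sum f I \<in> Rmax"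
  by (induction I rule: infinite_finite_induct) auto

lemma Rmax_inverse:
  assumes "x \<in> Rmax" "x \<noteq> 0"
  obtains y where "y \<in> Rmax" "y \<noteq> 0" "x * y = 1" "y * x = 1"
proof -
  obtain a where "x = Plain (ereal a)"
    using assms by (auto simp: Rmax_iff)
  then show thesis
    by (intro that[of "Plain (ereal (-a))"]) (auto simp: one_G_def zero_ereal_def)
qed

text \<open>Only nonzero elements of \<open>Rmax\<close> are invertible in \<open>G\<close>.
  Multiplication by \<open>Minus a\<close>, for instance, merges \<open>Plain (ereal b)\<close> with
  \<open>Minus b\<close>.\<close>

lemma times_G_cancel_le:
  assumes "l \<in> Rmax" "l \<noteq> 0"
  shows "l * x \<le> l * y \<longleftrightarrow> x \<le> (y :: G)"
proof
  obtain k where k: "k * l = 1"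
    using assms by (rule Rmax_inverse)
  assume "l * x \<le> l * y"
  then have "k * (l * x) \<le> k * (l * y)"
    by (rule times_G_left_mono)
  then show "x \<le> y"
    by (simp add: k flip: mult.assoc)
qed (rule times_G_left_mono)

lemma times_G_cancel_less:
  "l \<in> Rmax \<Longrightarrow> l \<noteq> 0 \<Longrightarrow> l * x < l * y \<longleftrightarrow> x < (y :: G)"
  by (simp add: times_G_cancel_le flip: not_le)

text \<open>For real \<open>y\<close> the product is a \<open>Minus\<close> element, which lies
  immediately below the real number of the same modulus, so the bound is strict. For
  \<open>y = 0\<close> the product is \<open>0\<close>, and only \<open>x = 0\<close> remains; this
  accounts for the first disjunct.\<close>

lemma le_Minus_iff:
  assumes "x \<in> Rmax" "y \<in> Rmax"
  shows "x \<le> Minus b * y \<longleftrightarrow> x = 0 \<or> x < Plain (ereal b) * y"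
  using assms
  by (cases rule: Rmax_cases[OF assms(1)]; cases rule: Rmax_cases[OF assms(2)])
    (auto simp: zero_G_def)


section \<open>Homogeneous mixed systems and Fourier-Motzkin elimination\<close>

definition solves :: "'v set \<Rightarrow> (('v \<Rightarrow> G) \<times> ('v \<Rightarrow> G)) set \<Rightarrow> ('v \<Rightarrow> G) \<Rightarrow> bool" where
  "solves V S x \<longleftrightarrow> (\<forall>c\<in>S. (\<Sum>v\<in>V. fst c v * x v) \<le> (\<Sum>v\<in>V. snd c v * x v))"

text \<open>Definability is required only on assignments with values in \<open>Rmax\<close>, so that
  it can be proved for arbitrary predicates, quantified ones included, without carrying a system
  along. The variable type is arbitrary because later tagged copies of the variables are
  needed.\<close>

definition mixed :: "'v set \<Rightarrow> (('v \<Rightarrow> G) \<Rightarrow> bool) \<Rightarrow> bool" where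
  "mixed V \<phi> \<longleftrightarrow>
    (\<exists>S. finite S \<and> (\<forall>c\<in>S. \<forall>v. fst c v \<in> Rmax) \<and>
      (\<forall>x. (\<forall>v\<in>V. x v \<in> Rmax) \<longrightarrow> \<phi> x = solves V S x))"

lemma mixedI:
  assumes "finite S" "\<And>c v. c \<in> S \<Longrightarrow> fst c v \<in> Rmax"
    "\<And>x. \<forall>v\<in>V. x v \<in> Rmax \<Longrightarrow> \<phi> x \<longleftrightarrow> solves V S x"
  shows "mixed V \<phi>"
  unfolding mixed_def using assms by (intro exI[of _ S]) simp

lemma solves_cong:
  assumes "\<And>v. v \<in> V \<Longrightarrow> x v = y v"
  shows "solves V S x \<longleftrightarrow> solves V S y"
proof -
  have "(\<Sum>v\<in>V. c v * x v) = (\<Sum>v\<in>V. c v * y v)" for c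
    using assms by (intro sum.cong) auto
  then show ?thesis
    by (simp add: solves_def)
qed

lemma mixed_cong:
  assumes "mixed V \<phi>" "\<And>x. (\<And>v. v \<in> V \<Longrightarrow> x v \<in> Rmax) \<Longrightarrow> \<phi> x \<longleftrightarrow> \<psi> x"
  shows "mixed V \<psi>"
proof -
  obtain S where "finite S" "\<And>c v. c \<in> S \<Longrightarrow> fst c v \<in> Rmax"
    "\<And>x. \<forall>v\<in>V. x v \<in> Rmax \<Longrightarrow> \<phi> x \<longleftrightarrow> solves V S x"
    using assms(1) unfolding mixed_def by blast
  then show ?thesis
    using assms(2) by (intro mixedI) blast+
qed

text \<open>A definable predicate may be an arbitrary function of the whole assignment. This lemma
  allows the values outside \<open>V\<close> to be changed.\<close>

lemma mixed_env_cong: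
  assumes "mixed V \<phi>" "\<And>v. v \<in> V \<Longrightarrow> x v \<in> Rmax" "\<And>v. v \<in> V \<Longrightarrow> x v = y v"
  shows "\<phi> x \<longleftrightarrow> \<phi> y"
proof -
  obtain S where S: "\<And>x. \<forall>v\<in>V. x v \<in> Rmax \<Longrightarrow> \<phi> x \<longleftrightarrow> solves V S x"
    using assms(1) unfolding mixed_def by blast
  have "\<forall>v\<in>V. y v \<in> Rmax"
    using assms(2,3) by fastforce
  then have "\<phi> y \<longleftrightarrow> solves V S y"
    by (rule S)
  moreover have "\<phi> x \<longleftrightarrow> solves V S x"
    using assms(2) by (intro S) blast
  ultimately show ?thesis
    using solves_cong[OF assms(3)] by simp
qed

section \<open>Closure properties of definable predicates\<close>

lemma mixed_True: "mixed V (\<lambda>x. True)"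
  by (rule mixedI[of "{}"]) (auto simp: solves_def)

lemma mixed_conj:
  assumes "mixed V \<phi>" "mixed V \<psi>"
  shows "mixed V (\<lambda>x. \<phi> x \<and> \<psi> x)"
proof -
  obtain S where S: "finite S" "\<And>c v. c \<in> S \<Longrightarrow> fst c v \<in> Rmax"
    "\<And>x. \<forall>v\<in>V. x v \<in> Rmax \<Longrightarrow> \<phi> x \<longleftrightarrow> solves V S x"
    using assms(1) unfolding mixed_def by blast
  obtain T where T: "finite T" "\<And>c v. c \<in> T \<Longrightarrow> fst c v \<in> Rmax"
    "\<And>x. \<forall>v\<in>V. x v \<in> Rmax \<Longrightarrow> \<psi> x \<longleftrightarrow> solves V T x"
    using assms(2) unfolding mixed_def by blast
  show ?thesis
  proof (rule mixedI)
    show "finite (S \<union> T)" "\<And>c v. c \<in> S \<union> T \<Longrightarrow> fst c v \<in> Rmax"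
      using S(1,2) T(1,2) by auto
    fix x assume x: "\<forall>v\<in>V. x v \<in> Rmax"
    show "\<phi> x \<and> \<psi> x \<longleftrightarrow> solves V (S \<union> T) x"
      using S(3)[OF x] T(3)[OF x] by (simp add: solves_def ball_Un)
  qed
qed

lemma mixed_Ball:
  "finite I \<Longrightarrow> (\<And>i. i \<in> I \<Longrightarrow> mixed V (\<phi> i)) \<Longrightarrow> mixed V (\<lambda>x. \<forall>i\<in>I. \<phi> i x)"
  by (induction rule: finite_induct) (auto intro: mixed_True mixed_conj)

lemma mixed_le:
  assumes "finite V" "s \<in> V" "t \<in> V" "p \<in> Rmax"
  shows "mixed V (\<lambda>x. p * x s \<le> q * x t)"
proof -
  have "(\<Sum>v\<in>V. (if v = u then c else 0) * x v) = c * x u" if "u \<in> V" for u c and x :: "'a \<Rightarrow> G"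
    using assms(1) that by (simp add: if_distrib[of "\<lambda>c. c * _"] sum.delta cong: if_cong)
  then show ?thesis
    using assms
    by (intro mixedI[of "{(\<lambda>v. if v = s then p else 0, \<lambda>v. if v = t then q else 0)}"])
      (auto simp: solves_def)
qed

lemma mixed_le_sum2:
  assumes "finite V" "s \<in> V" "t \<in> V" "u \<in> V"
  shows "mixed V (\<lambda>x. x s \<le> x t + x u)"
proof -
  have *: "(\<Sum>v\<in>V. (if v = w then 1 else 0) * x v) = x w" if "w \<in> V" for w and x :: "'a \<Rightarrow> G"
    using assms(1) that by (simp add: if_distrib[of "\<lambda>c. c * _"] sum.delta cong: if_cong)
  show ?thesis
    using assms
    by (intro mixedI[of "{(\<lambda>v. if v = s then 1 else 0,
          \<lambda>v. (if v = t then 1 else 0) + (if v = u then 1 else 0))}"])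
      (auto simp: solves_def distrib_right sum.distrib *)
qed

text \<open>By distributivity, the coefficient of a new variable is the sum of the coefficients of
  all old variables sent to it. The lemma serves both to pass to tagged copies and to remove the
  tag.\<close>

lemma mixed_rename:
  assumes "mixed V \<phi>" "finite V" "finite W" "f ` V \<subseteq> W"
  shows "mixed W (\<lambda>x. \<phi> (\<lambda>v. x (f v)))"
proof -
  obtain S where S: "finite S" "\<And>c v. c \<in> S \<Longrightarrow> fst c v \<in> Rmax"
    "\<And>x. \<forall>v\<in>V. x v \<in> Rmax \<Longrightarrow> \<phi> x \<longleftrightarrow> solves V S x"
    using assms(1) unfolding mixed_def by blast
  define push where "push c = (\<lambda>w. \<Sum>v | v \<in> V \<and> f v = w. c v)" for c :: "'a \<Rightarrow> G"
  have push: "(\<Sum>w\<in>W. push c w * x w) = (\<Sum>v\<in>V. c v * x (f v))" for c x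
  proof -
    have "(\<Sum>w\<in>W. push c w * x w) = (\<Sum>w\<in>W. \<Sum>v | v \<in> V \<and> f v = w. c v * x (f v))"
      by (intro sum.cong) (auto simp: push_def sum_distrib_right)
    also have "\<dots> = (\<Sum>v\<in>V. c v * x (f v))"
      using assms(2-4) by (rule sum.group)
    finally show ?thesis .
  qed
  show ?thesis
  proof (rule mixedI)
    show "finite (map_prod push push ` S)"
      using S(1) by simp
    show "fst c w \<in> Rmax" if "c \<in> map_prod push push ` S" for c w
      using that S(2) by (auto simp: push_def intro!: Rmax_sum)
    fix x assume "\<forall>w\<in>W. x w \<in> Rmax"
    then have "\<phi> (\<lambda>v. x (f v)) \<longleftrightarrow> solves V S (\<lambda>v. x (f v))"
      using assms(4) by (intro S(3)) auto
    then show "\<phi> (\<lambda>v. x (f v)) \<longleftrightarrow> solves W (map_prod push push ` S) x"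
      by (simp add: solves_def push)
  qed
qed

text \<open>
  Elements \<open>\<alpha>\<^sup>-\<close> and \<open>+\<infinity>\<close> are not admissible values of a variable, but they are suprema of
  admissible ones that are good enough for a single inequality.
\<close>

lemma Rmax_approx_below:
  assumes "A \<in> Rmax" "A \<le> \<beta> * m"
  obtains v where "v \<in> Rmax" "v \<le> m" "A \<le> \<beta> * v"
proof (cases "A = 0")
  case True
  then show thesis
    by (intro that[of 0]) auto
next
  case False
  then obtain a where A: "A = Plain (ereal a)"
    using assms(1) by (auto simp: Rmax_iff)
  then have "\<beta> \<noteq> 0"
    using assms(2) by auto
  show thesis
  proof (cases m rule: G_cases)
    case PInf
    \<comment> \<open>The summand \<open>1\<close> provides the strictness needed for
      \<open>Minus\<close> coefficients. For \<open>\<beta> = Plain \<infinity>\<close> the real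
      part of the modulus defaults to \<open>0\<close>, and any real witness works.\<close>
    then show thesis
      using A \<open>\<beta> \<noteq> 0\<close> that[of "Plain (ereal (a - real_of_ereal (modulus \<beta>) + 1))"]
      by (cases \<beta> rule: G_cases) (auto simp: zero_G_def)
  next
    case (Minus c)
    show thesis
    proof (cases \<beta> rule: G_cases)
      case (Minus b)
      \<comment> \<open>Both requirements are strict: the witness must exceed \<open>a - b\<close>
        and stay below \<open>c\<close>. The midpoint does both.\<close>
      then show thesis
        using assms(2) A \<open>m = Minus c\<close>
        by (intro that[of "Plain (ereal ((a - b + c) / 2))"]) (auto simp: field_simps)
    next
      case PInf
      then show thesis
        using \<open>m = Minus c\<close> by (intro that[of "Plain (ereal (c - 1))"]) auto
    next
      case (Real b)
      then show thesis
        using assms(2) A \<open>m = Minus c\<close> by (intro that[of "Plain (ereal (a - b))"]) auto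
    qed (use \<open>\<beta> \<noteq> 0\<close> in \<open>simp add: zero_G_def\<close>)
  next
    case MInf
    then show thesis
      using assms(2) A by simp
  next
    case (Real c)
    then show thesis
      using assms(2) by (intro that[of m]) auto
  qed
qed

text \<open>Right-hand sides increase with \<open>t\<close>, so the decisive value is the least
  upper bound in \<open>U\<close>. It may lie outside \<open>Rmax\<close>; then each inequality gets
  its own admissible witness below it, and the sum of these witnesses, being their maximum, is below
  it too and serves all inequalities at once. The condition for \<open>\<beta> i = 0\<close> covers
  the case of empty \<open>U\<close>.\<close>

lemma eliminate_scalar:
  assumes "finite U" "finite I" "\<And>i. i \<in> I \<Longrightarrow> A i \<in> Rmax"
  shows "(\<exists>t\<in>Rmax. (\<forall>u\<in>U. t \<le> u) \<and> (\<forall>i\<in>I. A i \<le> B i + \<beta> i * t)) \<longleftrightarrow>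
    (\<forall>i\<in>I. (\<beta> i = 0 \<longrightarrow> A i \<le> B i) \<and> (\<forall>u\<in>U. A i \<le> B i + \<beta> i * u))" (is "?L \<longleftrightarrow> ?R")
proof
  assume ?L
  then obtain t where t: "\<forall>u\<in>U. t \<le> u" "\<forall>i\<in>I. A i \<le> B i + \<beta> i * t"
    by blast
  show ?R
  proof (intro ballI conjI impI)
    fix i u assume "i \<in> I" "u \<in> U"
    then have "B i + \<beta> i * t \<le> B i + \<beta> i * u"
      using t(1) by (intro plus_G_mono times_G_left_mono) auto
    then show "A i \<le> B i + \<beta> i * u"
      using t(2) \<open>i \<in> I\<close> by (blast intro: order_trans)
  next
    fix i assume "i \<in> I" "\<beta> i = 0"
    moreover from \<open>i \<in> I\<close> t(2) have "A i \<le> B i + \<beta> i * t"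
      by blast
    ultimately show "A i \<le> B i"
      by simp
  qed
next
  assume R: ?R
  \<comment> \<open>The added \<open>Plain \<infinity>\<close> is the greatest element: it changes
    no minimum and stands for the absence of a bound when \<open>U\<close> is empty.\<close>
  define m where "m = Min (insert (Plain \<infinity>) U)"
  have m: "m \<in> insert (Plain \<infinity>) U"
    unfolding m_def by (rule Min_in) (use assms(1) in auto)
  have m_le: "m \<le> u" if "u \<in> U" for u
    unfolding m_def by (rule Min_le) (use assms(1) that in auto)
  have "\<exists>v. v \<in> Rmax \<and> v \<le> m \<and> A i \<le> B i + \<beta> i * v" if i: "i \<in> I" for i
  proof -
    have "A i \<le> B i + \<beta> i * m"
    proof (cases "m \<in> U")
      case True
      then show ?thesis
        using R i by blast
    next
      case False
      then have "m = Plain \<infinity>"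
        using m by blast
      moreover have "\<beta> i = 0 \<longrightarrow> A i \<le> B i"
        using R i by blast
      ultimately show ?thesis
        by (cases "\<beta> i = 0") (simp_all add: times_PInf_G le_plus_G_iff)
    qed
    then consider "A i \<le> B i" | "A i \<le> \<beta> i * m"
      by (auto simp: le_plus_G_iff)
    then show ?thesis
    proof cases
      case 1
      then show ?thesis
        by (intro exI[of _ 0]) (simp add: le_plus_G_iff)
    next
      case 2
      with assms(3)[OF i] obtain v where "v \<in> Rmax" "v \<le> m" "A i \<le> \<beta> i * v"
        by (rule Rmax_approx_below)
      then show ?thesis
        by (intro exI[of _ v]) (simp add: le_plus_G_iff)
    qed
  qed
  then have "\<forall>i\<in>I. \<exists>v. v \<in> Rmax \<and> v \<le> m \<and> A i \<le> B i + \<beta> i * v"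
    by blast
  from bchoice[OF this] obtain v where v: "\<And>i. i \<in> I \<Longrightarrow> v i \<in> Rmax"
    "\<And>i. i \<in> I \<Longrightarrow> v i \<le> m" "\<And>i. i \<in> I \<Longrightarrow> A i \<le> B i + \<beta> i * v i"
    by blast
  have "A i \<le> B i + \<beta> i * sum v I" if "i \<in> I" for i
  proof -
    have "v i \<le> sum v I"
      using assms(2) that by (subst le_sum_G_iff) auto
    then have "B i + \<beta> i * v i \<le> B i + \<beta> i * sum v I"
      by (intro plus_G_mono times_G_left_mono) auto
    then show ?thesis
      using v(3)[OF that] by (rule order_trans[rotated])
  qed
  moreover have "sum v I \<le> m"
    using assms(2) v(2) by (simp add: sum_G_le_iff)
  then have "\<forall>u\<in>U. sum v I \<le> u"
    using m_le order_trans by blast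
  ultimately show ?L
    using v(1) by (intro bexI[of _ "sum v I"]) (auto intro: Rmax_sum)
qed

section \<open>Elimination of variables from a system\<close>

text \<open>The order is total, so either \<open>\<alpha> * t\<close> is absorbed by
  \<open>\<beta> * t\<close>, or \<open>\<beta> < \<alpha>\<close> and, for
  \<open>t \<noteq> 0\<close>, only \<open>B\<close> can dominate \<open>\<alpha> * t\<close>. In
  the second case \<open>\<alpha>\<close> is real and \<open>Plain (- modulus \<alpha>)\<close> is
  its inverse.\<close>

lemma split_ineq:
  assumes "t \<in> Rmax" "\<alpha> \<in> Rmax"
  shows "A + \<alpha> * t \<le> B + \<beta> * t \<longleftrightarrow>
    A \<le> B + \<beta> * t \<and> (\<beta> < \<alpha> \<longrightarrow> t \<le> Plain (- modulus \<alpha>) * B)"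
proof -
  have "\<alpha> * t \<le> B + \<beta> * t \<longleftrightarrow> (\<beta> < \<alpha> \<longrightarrow> t \<le> Plain (- modulus \<alpha>) * B)"
  proof (cases "\<beta> < \<alpha>")
    case False
    then have "\<alpha> * t \<le> \<beta> * t"
      by (intro times_G_mono) auto
    then show ?thesis
      using False by (auto simp: le_plus_G_iff)
  next
    case True
    then have "\<alpha> \<noteq> 0"
      by (metis not_le zero_le_G)
    then obtain a where a: "\<alpha> = Plain (ereal a)"
      using assms(2) by (auto simp: Rmax_iff)
    have "\<not> \<alpha> * t \<le> \<beta> * t" if "t \<noteq> 0"
      using times_G_cancel_le[OF assms(1) that, of \<alpha> \<beta>] True by (simp add: mult.commute not_le)
    moreover have "\<alpha> * t \<le> B \<longleftrightarrow> t \<le> Plain (ereal (-a)) * B"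
      using times_G_cancel_le[of "Plain (ereal (-a))" "\<alpha> * t" B]
      by (simp add: a flip: mult.assoc) (simp flip: zero_ereal_def one_G_def)
    ultimately show ?thesis
      using True by (cases "t = 0") (auto simp: le_plus_G_iff a)
  qed
  then show ?thesis
    by auto
qed

lemma mixed_ex1:
  assumes "mixed (insert w V) \<phi>" "finite V" "w \<notin> V"
  shows "mixed V (\<lambda>x. \<exists>t\<in>Rmax. \<phi> (x(w := t)))"
proof -
  obtain S where S: "finite S" "\<And>c v. c \<in> S \<Longrightarrow> fst c v \<in> Rmax"
    "\<And>x. \<forall>v\<in>insert w V. x v \<in> Rmax \<Longrightarrow> \<phi> x \<longleftrightarrow> solves (insert w V) S x"
    using assms(1) unfolding mixed_def by blast
  \<comment> \<open>\<open>U\<close> collects the inequalities that bound the eliminated variable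
    from above; \<open>comb (c, d)\<close> substitutes the bound given by \<open>d\<close> into the
    right-hand side of \<open>c\<close>. Left-hand coefficients are untouched and so remain in
    \<open>Rmax\<close>.\<close>
  define U where "U = {c \<in> S. snd c w < fst c w}"
  define ginv where "ginv c = Plain (- modulus (fst c w))" for c :: "('a \<Rightarrow> G) \<times> ('a \<Rightarrow> G)"
  define comb where "comb = (\<lambda>(c, d).
    (fst c, \<lambda>v. snd c v + snd c w * (ginv d * snd d v)) :: ('a \<Rightarrow> G) \<times> ('a \<Rightarrow> G))"
  \<comment> \<open>The first set matters when \<open>U\<close> is empty: inequalities whose
    right-hand side does not involve \<open>w\<close> must survive, while all others can be met by a
    large value of \<open>w\<close>.\<close>
  define T where "T = {c \<in> S. snd c w = 0} \<union> comb ` (S \<times> U)"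
  have "finite T"
    using S(1) by (simp add: T_def U_def)
  moreover have "fst c v \<in> Rmax" if "c \<in> T" for c v
    using that S(2) by (cases c) (auto simp: T_def comb_def)
  moreover have "(\<exists>t\<in>Rmax. \<phi> (x(w := t))) \<longleftrightarrow> solves V T x"
    if x: "\<forall>v\<in>V. x v \<in> Rmax" for x
  proof -
    define A where "A c = (\<Sum>v\<in>V. fst c v * x v)" for c :: "('a \<Rightarrow> G) \<times> ('a \<Rightarrow> G)"
    define B where "B c = (\<Sum>v\<in>V. snd c v * x v)" for c :: "('a \<Rightarrow> G) \<times> ('a \<Rightarrow> G)"
    have A: "A c \<in> Rmax" if "c \<in> S" for c
      unfolding A_def using S(2) that x by (intro Rmax_sum) auto
    have sums: "(\<Sum>v\<in>insert w V. c v * (x(w := t)) v) = (\<Sum>v\<in>V. c v * x v) + c w * t" for c t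
    proof -
      have "(\<Sum>v\<in>V. c v * (x(w := t)) v) = (\<Sum>v\<in>V. c v * x v)"
        using assms(3) by (intro sum.cong) auto
      then show ?thesis
        using assms(2,3) by (simp add: add.commute)
    qed
    have "\<phi> (x(w := t)) \<longleftrightarrow>
        (\<forall>u \<in> (\<lambda>d. ginv d * B d) ` U. t \<le> u) \<and> (\<forall>c\<in>S. A c \<le> B c + snd c w * t)"
      if t: "t \<in> Rmax" for t
    proof -
      have "\<forall>v\<in>insert w V. (x(w := t)) v \<in> Rmax"
        using x t by auto
      then have "\<phi> (x(w := t)) \<longleftrightarrow> (\<forall>c\<in>S. A c + fst c w * t \<le> B c + snd c w * t)"
        unfolding A_def B_def by (simp only: S(3) solves_def sums)
      also have "\<dots> \<longleftrightarrow> (\<forall>c\<in>S. A c \<le> B c + snd c w * t \<and> (snd c w < fst c w \<longrightarrow> t \<le> ginv c * B c))"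
        unfolding ginv_def using split_ineq[OF t S(2)] by (intro ball_cong) auto
      finally show ?thesis
        by (auto simp: U_def)
    qed
    then have "(\<exists>t\<in>Rmax. \<phi> (x(w := t))) \<longleftrightarrow>
        (\<exists>t\<in>Rmax. (\<forall>u \<in> (\<lambda>d. ginv d * B d) ` U. t \<le> u) \<and> (\<forall>c\<in>S. A c \<le> B c + snd c w * t))"
      by (intro bex_cong) auto
    also have "\<dots> \<longleftrightarrow> (\<forall>c\<in>S. (snd c w = 0 \<longrightarrow> A c \<le> B c) \<and>
        (\<forall>u \<in> (\<lambda>d. ginv d * B d) ` U. A c \<le> B c + snd c w * u))"
      using S(1) A by (intro eliminate_scalar) (auto simp: U_def)
    also have "\<dots> \<longleftrightarrow> (\<forall>c\<in>T. A c \<le> B c)"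
    proof -
      have "A (comb (c, d)) = A c" "B (comb (c, d)) = B c + snd c w * (ginv d * B d)" for c d
        by (simp_all add: A_def B_def comb_def distrib_right sum.distrib sum_distrib_left mult.assoc)
      then show ?thesis
        by (auto simp: T_def ball_Un)
    qed
    finally show ?thesis
      by (simp add: solves_def A_def B_def)
  qed
  ultimately show ?thesis
    by (rule mixedI)
qed

lemma mixed_ex:
  assumes "finite W" "finite V" "V \<inter> W = {}" "mixed (V \<union> W) \<phi>"
  shows "mixed V (\<lambda>x. \<exists>y. (\<forall>w\<in>W. y w \<in> Rmax) \<and> \<phi> (override_on x y W))"
  using assms
proof (induction W arbitrary: \<phi> rule: finite_induct)
  case empty
  then show ?case
    by simp
next
  case (insert w W)
  have "mixed (V \<union> W) (\<lambda>x. \<exists>t\<in>Rmax. \<phi> (x(w := t)))"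
    by (rule mixed_ex1) (use insert.prems insert.hyps in auto)
  then have "mixed V (\<lambda>x. \<exists>y. (\<forall>w\<in>W. y w \<in> Rmax) \<and> (\<exists>t\<in>Rmax. \<phi> ((override_on x y W)(w := t))))"
    by (rule insert.IH[rotated 2]) (use insert.prems in auto)
  then show ?case
  proof (rule mixed_cong)
    fix x :: "'a \<Rightarrow> G"
    have *: "(override_on x y W)(w := t) = override_on x (y(w := t)) (insert w W)" for y t
      by (auto simp: override_on_def fun_eq_iff)
    show "(\<exists>y. (\<forall>w\<in>W. y w \<in> Rmax) \<and> (\<exists>t\<in>Rmax. \<phi> ((override_on x y W)(w := t)))) \<longleftrightarrow>
        (\<exists>y. (\<forall>w\<in>insert w W. y w \<in> Rmax) \<and> \<phi> (override_on x y (insert w W)))" (is "?L \<longleftrightarrow> ?R")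
    proof
      assume ?L
      then obtain y t where "\<forall>w\<in>W. y w \<in> Rmax" "t \<in> Rmax" "\<phi> ((override_on x y W)(w := t))"
        by blast
      then show ?R
        unfolding * by (intro exI[of _ "y(w := t)"]) simp
    next
      assume ?R
      then obtain y where "\<forall>w\<in>insert w W. y w \<in> Rmax" "\<phi> (override_on x y (insert w W))"
        by blast
      then show ?L
        unfolding * by (intro exI[of _ y] conjI bexI[of _ "y w"]) simp_all
    qed
  qed
qed

section \<open>Sums of definable sets as projections\<close>

definition cone_sum ::
  "'v set \<Rightarrow> (('v \<Rightarrow> G) \<Rightarrow> bool) \<Rightarrow> (('v \<Rightarrow> G) \<Rightarrow> bool) \<Rightarrow> ('v \<Rightarrow> G) \<Rightarrow> bool" where
  "cone_sum V \<phi> \<psi> z \<longleftrightarrow> (\<exists>x y. (\<forall>v\<in>V. x v \<in> Rmax) \<and> (\<forall>v\<in>V. y v \<in> Rmax) \<and>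
    \<phi> x \<and> \<psi> y \<and> (\<forall>v\<in>V. z v = x v + y v))"

text \<open>The sum is a projection. Copy \<open>0\<close> of the variables holds the result, copies
  \<open>1\<close> and \<open>2\<close> hold the summands, and since addition is a maximum, equality
  with the sum amounts to three weak inequalities. Eliminating copies \<open>1\<close> and
  \<open>2\<close> leaves the claim.\<close>

lemma mixed_cone_sum:
  assumes "finite V" "mixed V \<phi>" "mixed V \<psi>"
  shows "mixed V (cone_sum V \<phi> \<psi>)"
proof -
  define W where "W = {1, 2 :: nat} \<times> V"
  let ?V = "Pair (0 :: nat) ` V"
  let ?f = "\<lambda>x. \<phi> (\<lambda>v. x (1, v)) \<and> \<psi> (\<lambda>v. x (2, v)) \<and>
    (\<forall>v\<in>V. x (0, v) \<le> x (1, v) + x (2, v)) \<and>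
    (\<forall>v\<in>V. 1 * x (1, v) \<le> 1 * x (0, v)) \<and> (\<forall>v\<in>V. 1 * x (2, v) \<le> 1 * x (0, v))"
  have "mixed (?V \<union> W) (\<lambda>x. \<phi> (\<lambda>v. x (1, v)))" "mixed (?V \<union> W) (\<lambda>x. \<psi> (\<lambda>v. x (2, v)))"
    by (rule mixed_rename[OF assms(2)] mixed_rename[OF assms(3)]; use assms(1) in \<open>auto simp: W_def\<close>)+
  then have "mixed (?V \<union> W) ?f"
    using assms(1) by (intro mixed_conj mixed_Ball mixed_le mixed_le_sum2) (simp_all add: W_def)
  then have "mixed ?V (\<lambda>x. \<exists>y. (\<forall>w\<in>W. y w \<in> Rmax) \<and> ?f (override_on x y W))"
    by (rule mixed_ex[rotated 3]) (use assms(1) in \<open>auto simp: W_def\<close>)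
  \<comment> \<open>Renaming along \<open>snd\<close> strips the tag \<open>0\<close> from the
    remaining variables.\<close>
  then have "mixed V (\<lambda>x. \<exists>y. (\<forall>w\<in>W. y w \<in> Rmax) \<and> ?f (override_on (\<lambda>v. x (snd v)) y W))"
    by (rule mixed_rename) (use assms(1) in auto)
  then show ?thesis
  proof (rule mixed_cong)
    fix z :: "'a \<Rightarrow> G"
    have eq: "?f (override_on (\<lambda>v. z (snd v)) y W) \<longleftrightarrow>
        \<phi> (\<lambda>v. override_on (\<lambda>v. z (snd v)) y W (1, v)) \<and> \<psi> (\<lambda>v. override_on (\<lambda>v. z (snd v)) y W (2, v)) \<and>
        (\<forall>v\<in>V. z v = y (1, v) + y (2, v))" for y
    proof -
      let ?u = "override_on (\<lambda>v. z (snd v)) y W"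
      have le: "r \<le> p + q \<and> 1 * p \<le> 1 * r \<and> 1 * q \<le> 1 * r \<longleftrightarrow> r = p + q" for p q r :: G
        using le_plus_G_iff[of p p q] le_plus_G_iff[of q p q] by (auto intro!: antisym)
      have "(\<forall>v\<in>V. ?u (0, v) \<le> ?u (1, v) + ?u (2, v)) \<and> (\<forall>v\<in>V. 1 * ?u (1, v) \<le> 1 * ?u (0, v)) \<and>
          (\<forall>v\<in>V. 1 * ?u (2, v) \<le> 1 * ?u (0, v)) \<longleftrightarrow> (\<forall>v\<in>V. ?u (0, v) = ?u (1, v) + ?u (2, v))"
        by (simp only: ball_conj_distrib[symmetric] le)
      also have "\<dots> \<longleftrightarrow> (\<forall>v\<in>V. z v = y (1, v) + y (2, v))"
        by (intro ball_cong) (simp_all add: override_on_def W_def)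
      finally show ?thesis
        by (simp only:)
    qed
    show "(\<exists>y. (\<forall>w\<in>W. y w \<in> Rmax) \<and> ?f (override_on (\<lambda>v. z (snd v)) y W)) \<longleftrightarrow> cone_sum V \<phi> \<psi> z"
      (is "?L \<longleftrightarrow> ?R")
    proof
      assume ?L
      then obtain y where y: "\<forall>w\<in>W. y w \<in> Rmax"
        "\<phi> (\<lambda>v. override_on (\<lambda>v. z (snd v)) y W (1, v))"
        "\<psi> (\<lambda>v. override_on (\<lambda>v. z (snd v)) y W (2, v))"
        "\<forall>v\<in>V. z v = y (1, v) + y (2, v)"
        unfolding eq by blast
      show ?R
        unfolding cone_sum_def
        by (rule exI[of _ "\<lambda>v. override_on (\<lambda>v. z (snd v)) y W (1, v)"],
            rule exI[of _ "\<lambda>v. override_on (\<lambda>v. z (snd v)) y W (2, v)"])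
          (use y in \<open>simp add: override_on_def W_def\<close>)
    next
      assume ?R
      then obtain x y where xy: "\<forall>v\<in>V. x v \<in> Rmax" "\<forall>v\<in>V. y v \<in> Rmax" "\<phi> x" "\<psi> y"
        "\<forall>v\<in>V. z v = x v + y v"
        unfolding cone_sum_def by blast
      define u where "u = (\<lambda>(i :: nat, v). if i = 1 then x v else y v)"
      let ?u = "override_on (\<lambda>v. z (snd v)) u W"
      have "\<phi> x \<longleftrightarrow> \<phi> (\<lambda>v. ?u (1, v))"
        by (rule mixed_env_cong[OF assms(2)]) (use xy in \<open>simp_all add: override_on_def W_def u_def\<close>)
      moreover have "\<psi> y \<longleftrightarrow> \<psi> (\<lambda>v. ?u (2, v))"
        by (rule mixed_env_cong[OF assms(3)]) (use xy in \<open>simp_all add: override_on_def W_def u_def\<close>)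
      ultimately have "\<phi> (\<lambda>v. ?u (1, v))" "\<psi> (\<lambda>v. ?u (2, v))"
        using xy(3,4) by blast+
      moreover have "\<forall>w\<in>W. u w \<in> Rmax" "\<forall>v\<in>V. z v = u (1, v) + u (2, v)"
        using xy by (auto simp: W_def u_def)
      ultimately show ?L
        unfolding eq by blast
    qed
  qed
qed


section \<open>Homogenisation\<close>

text \<open>This is the vector with the constant prepended and all other indices shifted by one. It
  is applied to points, with constant \<open>1\<close>, and to coefficient vectors alike, so that an
  affine form becomes a single sum over \<open>{..n}\<close>.\<close>

definition homog :: "G \<Rightarrow> G vec \<Rightarrow> nat \<Rightarrow> G" where
  "homog c x i = (case i of 0 \<Rightarrow> c | Suc j \<Rightarrow> x $ j)"

lemma homog_simps [simp]: "homog c x 0 = c" "homog c x (Suc j) = x $ j"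
  by (simp_all add: homog_def)

lemma homog_Rmax:
  assumes "c \<in> Rmax" "x \<in> Rmax_vec n" "i \<le> n"
  shows "homog c x i \<in> Rmax"
  using assms by (cases i) (auto simp: Rmax_vec_def)

text \<open>In coordinate \<open>0\<close> this is exactly the normalisation
  \<open>l + m = 1\<close>.\<close>

lemma homog_convex_comb:
  assumes "x \<in> Rmax_vec n" "y \<in> Rmax_vec n" "l + m = 1" "i \<le> n"
  shows "homog 1 (l \<cdot>\<^sub>v x + m \<cdot>\<^sub>v y) i = l * homog 1 x i + m * homog 1 y i"
  using assms by (cases i) (auto simp: Rmax_vec_def)

lemma affine_eq_sum:
  assumes "x \<in> Rmax_vec n"
  shows "b0 + b \<bullet> x = (\<Sum>i\<le>n. homog b0 b i * homog 1 x i)"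
proof -
  have "dim_vec x = n"
    using assms by (auto simp: Rmax_vec_def)
  then show ?thesis
    by (simp add: sum.atMost_shift scalar_prod_def atLeast0LessThan)
qed

lemma satisfies_iff_sum:
  assumes "x \<in> Rmax_vec n"
  shows "satisfies x (a0, a, b0, b) \<longleftrightarrow>
    (\<Sum>i\<le>n. homog a0 a i * homog 1 x i) \<le> (\<Sum>i\<le>n. homog b0 b i * homog 1 x i)"
  using assms by (simp add: satisfies_def affine_eq_sum)

lemma mixed_imp_polyhedron:
  assumes "mixed {..n} \<phi>" "P = {x \<in> Rmax_vec n. \<phi> (homog 1 x)}"
  shows "mixed_tropical_polyhedron n P"
proof -
  obtain S where S: "finite S" "\<And>c v. c \<in> S \<Longrightarrow> fst c v \<in> Rmax"
    "\<And>x. \<forall>v\<in>{..n}. x v \<in> Rmax \<Longrightarrow> \<phi> x \<longleftrightarrow> solves {..n} S x"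
    using assms(1) unfolding mixed_def by blast
  define f where "f c = (fst c 0, vec n (\<lambda>i. fst c (Suc i)), snd c 0, vec n (\<lambda>i. snd c (Suc i)))"
    for c :: "(nat \<Rightarrow> G) \<times> (nat \<Rightarrow> G)"
  have coeff: "homog (g 0) (vec n (\<lambda>i. g (Suc i))) i = g i" if "i \<le> n" for g i
    using that by (cases i) auto
  have "\<phi> (homog 1 x) \<longleftrightarrow> (\<forall>c\<in>f ` S. satisfies x c)" if x: "x \<in> Rmax_vec n" for x
  proof -
    have "satisfies x (f c) \<longleftrightarrow>
        (\<Sum>i\<le>n. fst c i * homog 1 x i) \<le> (\<Sum>i\<le>n. snd c i * homog 1 x i)" for c
      unfolding f_def satisfies_iff_sum[OF x] by (simp add: coeff)
    moreover have "\<phi> (homog 1 x) \<longleftrightarrow> solves {..n} S (homog 1 x)"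
      using x by (intro S(3)) (auto intro: homog_Rmax)
    ultimately show ?thesis
      by (simp add: solves_def)
  qed
  moreover have "f ` S \<subseteq> mixed_ineqs n"
    using S(2) by (auto simp: f_def mixed_ineqs_def Rmax_vec_def)
  ultimately show ?thesis
    unfolding mixed_tropical_polyhedron_def using S(1) assms(2)
    by (intro exI[of _ "f ` S"]) auto
qed

text \<open>Both homogenised sides are linear forms, and addition and multiplication are monotone,
  so the inequality for the combination is the combination of the two given ones.\<close>

lemma polyhedron_convex:
  assumes "mixed_tropical_polyhedron n P"
  shows "tropically_convex P"
proof -
  obtain S where P: "P = {x \<in> Rmax_vec n. \<forall>c\<in>S. satisfies x c}"
    using assms unfolding mixed_tropical_polyhedron_def by blast
  show ?thesis
    unfolding tropically_convex_def
  proof (intro ballI impI)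
    fix x y l m
    assume x: "x \<in> P" and y: "y \<in> P" and lm: "l \<in> Rmax" "m \<in> Rmax" "l + m = 1"
    let ?z = "l \<cdot>\<^sub>v x + m \<cdot>\<^sub>v y"
    have xy: "x \<in> Rmax_vec n" "y \<in> Rmax_vec n"
      using x y P by auto
    then have z: "?z \<in> Rmax_vec n"
      using lm by (auto simp: Rmax_vec_def)
    have "satisfies ?z c" if "c \<in> S" for c
    proof -
      obtain a0 a b0 b where c: "c = (a0, a, b0, b)"
        by (cases c)
      have sum: "(\<Sum>i\<le>n. g i * homog 1 ?z i) =
          l * (\<Sum>i\<le>n. g i * homog 1 x i) + m * (\<Sum>i\<le>n. g i * homog 1 y i)" for g
      proof -
        have "(\<Sum>i\<le>n. g i * homog 1 ?z i) = (\<Sum>i\<le>n. l * (g i * homog 1 x i) + m * (g i * homog 1 y i))"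
          using homog_convex_comb[OF xy lm(3)] by (intro sum.cong) (auto simp: algebra_simps)
        then show ?thesis
          by (simp add: sum.distrib sum_distrib_left)
      qed
      have "satisfies x c" "satisfies y c"
        using x y P that by auto
      then show ?thesis
        unfolding c satisfies_iff_sum[OF xy(1)] satisfies_iff_sum[OF xy(2)] satisfies_iff_sum[OF z] sum
        by (intro plus_G_mono times_G_left_mono)
    qed
    then show "?z \<in> P"
      using z P by blast
  qed
qed


section \<open>Finite unions of zones\<close>

text \<open>Phrasing this for predicates lets the quantifiers over terms of an inequality be handled
  as finite Boolean operations. The empty family yields the false predicate.\<close>

definition zone_union :: "nat \<Rightarrow> (G vec \<Rightarrow> bool) \<Rightarrow> bool" where
  "zone_union n \<phi> \<longleftrightarrow>
    (\<exists>F. finite F \<and> (\<forall>Z\<in>F. zone n Z) \<and> {x \<in> Rmax_vec n. \<phi> x} = \<Union>F)"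

lemma zone_union_cong:
  assumes "zone_union n \<phi>" "\<And>x. x \<in> Rmax_vec n \<Longrightarrow> \<phi> x \<longleftrightarrow> \<psi> x"
  shows "zone_union n \<psi>"
proof -
  have "{x \<in> Rmax_vec n. \<phi> x} = {x \<in> Rmax_vec n. \<psi> x}"
    using assms(2) by blast
  then show ?thesis
    using assms(1) by (simp add: zone_union_def)
qed

lemma zone_Int:
  assumes "zone n A" "zone n B"
  shows "zone n (A \<inter> B)"
proof -
  obtain Q Q' where Q: "finite Q" "\<forall>q\<in>Q. zone_ineq n q" "A = {x \<in> Rmax_vec n. \<forall>q\<in>Q. q x}"
    and Q': "finite Q'" "\<forall>q\<in>Q'. zone_ineq n q" "B = {x \<in> Rmax_vec n. \<forall>q\<in>Q'. q x}"
    using assms unfolding zone_def by blast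
  have "A \<inter> B = {x \<in> Rmax_vec n. \<forall>q\<in>Q \<union> Q'. q x}"
    unfolding Q(3) Q'(3) by blast
  moreover have "finite (Q \<union> Q')" "\<forall>q\<in>Q \<union> Q'. zone_ineq n q"
    using Q(1,2) Q'(1,2) by auto
  ultimately show ?thesis
    unfolding zone_def by (intro exI[of _ "Q \<union> Q'"]) simp
qed

lemma zone_union_ineq:
  assumes "zone_ineq n q"
  shows "zone_union n q"
proof -
  have "zone n {x \<in> Rmax_vec n. q x}"
    unfolding zone_def using assms by (intro exI[of _ "{q}"]) simp
  then show ?thesis
    unfolding zone_union_def by (intro exI[of _ "{{x \<in> Rmax_vec n. q x}}"]) simp
qed

lemma zone_union_const: "zone_union n (\<lambda>x. b)"
proof (cases b)
  case True
  have "zone n (Rmax_vec n)"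
    unfolding zone_def by (intro exI[of _ "{}"]) simp
  then show ?thesis
    unfolding zone_union_def using True by (intro exI[of _ "{Rmax_vec n}"]) simp
next
  case False
  then show ?thesis
    unfolding zone_union_def by (intro exI[of _ "{}"]) simp
qed

lemma zone_union_disj:
  assumes "zone_union n \<phi>" "zone_union n \<psi>"
  shows "zone_union n (\<lambda>x. \<phi> x \<or> \<psi> x)"
proof -
  obtain F F' where F: "finite F" "\<forall>Z\<in>F. zone n Z" "{x \<in> Rmax_vec n. \<phi> x} = \<Union>F"
    and F': "finite F'" "\<forall>Z\<in>F'. zone n Z" "{x \<in> Rmax_vec n. \<psi> x} = \<Union>F'"
    using assms unfolding zone_union_def by blast
  have "{x \<in> Rmax_vec n. \<phi> x \<or> \<psi> x} = \<Union>(F \<union> F')"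
    unfolding Union_Un_distrib F(3)[symmetric] F'(3)[symmetric] by blast
  moreover have "finite (F \<union> F')" "\<forall>Z\<in>F \<union> F'. zone n Z"
    using F(1,2) F'(1,2) by auto
  ultimately show ?thesis
    unfolding zone_union_def by (intro exI[of _ "F \<union> F'"]) simp
qed

lemma zone_union_conj:
  assumes "zone_union n \<phi>" "zone_union n \<psi>"
  shows "zone_union n (\<lambda>x. \<phi> x \<and> \<psi> x)"
proof -
  obtain F F' where F: "finite F" "\<forall>Z\<in>F. zone n Z" "{x \<in> Rmax_vec n. \<phi> x} = \<Union>F"
    and F': "finite F'" "\<forall>Z\<in>F'. zone n Z" "{x \<in> Rmax_vec n. \<psi> x} = \<Union>F'"
    using assms unfolding zone_union_def by blast
  let ?G = "(\<lambda>(A, B). A \<inter> B) ` (F \<times> F')"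
  have "{x \<in> Rmax_vec n. \<phi> x \<and> \<psi> x} = \<Union>F \<inter> \<Union>F'"
    unfolding F(3)[symmetric] F'(3)[symmetric] by blast
  also have "\<dots> = \<Union>?G"
    by auto
  finally have "{x \<in> Rmax_vec n. \<phi> x \<and> \<psi> x} = \<Union>?G" .
  moreover have "finite ?G" "\<forall>Z\<in>?G. zone n Z"
    using F(1,2) F'(1,2) by (auto intro: zone_Int)
  ultimately show ?thesis
    unfolding zone_union_def by (intro exI[of _ ?G]) simp
qed

lemma zone_union_Ball:
  assumes "finite I" "\<And>i. i \<in> I \<Longrightarrow> zone_union n (\<phi> i)"
  shows "zone_union n (\<lambda>x. \<forall>i\<in>I. \<phi> i x)"
  using assms by (induction rule: finite_induct) (simp_all add: zone_union_const zone_union_conj)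

lemma zone_union_Bex:
  assumes "finite I" "\<And>i. i \<in> I \<Longrightarrow> zone_union n (\<phi> i)"
  shows "zone_union n (\<lambda>x. \<exists>i\<in>I. \<phi> i x)"
  using assms by (induction rule: finite_induct) (simp_all add: zone_union_const zone_union_disj)

lemma times_G_cancel_rel:
  assumes "R \<in> {(\<le>), (<)}" "l \<in> Rmax" "l \<noteq> 0"
  shows "R (l * x) (l * y) \<longleftrightarrow> R x (y :: G)"
  using assms by (auto simp: times_G_cancel_le times_G_cancel_less)

text \<open>Zone inequalities carry a coefficient on one side at most, so \<open>p\<close> is
  divided out when it is nonzero. What remains is an upper bound, a difference, a lower bound after
  dividing by \<open>r\<close>, or a condition independent of \<open>x\<close>. For
  \<open>p = 0\<close> only a strict inequality can say something, namely that a coordinate is not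
  \<open>0\<close>.\<close>

lemma zone_union_Rmax:
  assumes R: "R \<in> {(\<le>), (<)}" and p: "p \<in> Rmax" and q: "q \<in> Rmax" and ik: "i \<le> n" "k \<le> n"
  shows "zone_union n (\<lambda>x. R (p * homog 1 x i) (q * homog 1 x k))"
proof (cases "p = 0")
  case True
  consider "R = (\<le>)" | "R = (<)" "q = 0" | "R = (<)" "q \<noteq> 0" "k = 0"
    | j where "R = (<)" "q \<noteq> 0" "k = Suc j"
    using R by (cases k) auto
  then show ?thesis
  proof cases
    case 4
    have "zone_union n (\<lambda>x. 0 < x $ j)"
      using 4 ik by (intro zone_union_ineq zone_ineq.lower) auto
    then show ?thesis
      using 4 True by simp
  qed (use True in \<open>simp_all add: zone_union_const\<close>)
next
  case False
  obtain p' where p': "p' \<in> Rmax" "p' \<noteq> 0" "p' * p = 1"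
    using p False by (rule Rmax_inverse)
  define r where "r = p' * q"
  have r: "r \<in> Rmax"
    using p' q by (simp add: r_def)
  have "R (p * s) (q * t) \<longleftrightarrow> R s (r * t)" for s t
    using times_G_cancel_rel[OF R p'(1,2), of "p * s" "q * t"] p'(3)
    by (simp add: r_def flip: mult.assoc)
  moreover have "zone_union n (\<lambda>x. R (homog 1 x i) (r * homog 1 x k))"
  proof (cases i)
    case i: 0
    show ?thesis
    proof (cases k)
      case (Suc j)
      show ?thesis
      proof (cases "r = 0")
        case True
        then show ?thesis
          using i by (simp add: zone_union_const)
      next
        case False
        obtain r' where r': "r' \<in> Rmax" "r' \<noteq> 0" "r' * r = 1"
          using r False by (rule Rmax_inverse)
        have "R 1 (r * t) \<longleftrightarrow> R r' t" for t
          using times_G_cancel_rel[OF R r'(1,2), of 1 "r * t"] r'(3)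
          by (simp flip: mult.assoc)
        moreover have "zone_union n (\<lambda>x. R r' (x $ j))"
          using R r' Suc ik by (intro zone_union_ineq zone_ineq.lower) auto
        ultimately show ?thesis
          using i Suc by simp
      qed
    qed (use i in \<open>simp add: zone_union_const\<close>)
  next
    case i: (Suc i')
    show ?thesis
    proof (cases k)
      case 0
      have "zone_union n (\<lambda>x. R (x $ i') r)"
        using R r i ik by (intro zone_union_ineq zone_ineq.upper) auto
      then show ?thesis
        using i 0 by simp
    next
      case (Suc j)
      have "zone_union n (\<lambda>x. R (x $ i') (r * x $ j))"
        using R r i Suc ik by (intro zone_union_ineq zone_ineq.diff) auto
      then show ?thesis
        using i Suc by simp
    qed
  qed
  ultimately show ?thesis
    by simp
qed

lemma zone_union_le:
  assumes a: "a \<in> Rmax" and ik: "i \<le> n" "k \<le> n"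
  shows "zone_union n (\<lambda>x. a * homog 1 x i \<le> b * homog 1 x k)"
proof -
  have le: "zone_union n (\<lambda>x. p * homog 1 x i \<le> q * homog 1 x k)" if "p \<in> Rmax" "q \<in> Rmax" for p q
    using zone_union_Rmax[of "(\<le>)"] that ik by auto
  have less: "zone_union n (\<lambda>x. p * homog 1 x i < q * homog 1 x k)" if "p \<in> Rmax" "q \<in> Rmax" for p q
    using zone_union_Rmax[of "(<)"] that ik by auto
  show ?thesis
  proof (cases b rule: G_cases)
    case PInf
    \<comment> \<open>A product with \<open>Plain \<infinity>\<close> is either \<open>0\<close> or
      the greatest element. The second disjunct says that coordinate \<open>k\<close> is not
      \<open>0\<close>, written in the form that \<open>less\<close> provides.\<close>
    have "zone_union n (\<lambda>x. a * homog 1 x i \<le> 0 * homog 1 x k \<or> 0 * homog 1 x i < 1 * homog 1 x k)"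
      using a by (intro zone_union_disj le less) auto
    then show ?thesis
    proof (rule zone_union_cong)
      show "a * homog 1 x i \<le> 0 * homog 1 x k \<or> 0 * homog 1 x i < 1 * homog 1 x k \<longleftrightarrow>
          a * homog 1 x i \<le> b * homog 1 x k" for x
        by (cases "homog 1 x k = 0") (simp_all add: PInf times_PInf_G)
    qed
  next
    case (Minus \<beta>)
    have "zone_union n (\<lambda>x. a * homog 1 x i \<le> 0 * homog 1 x k \<or>
        a * homog 1 x i < Plain (ereal \<beta>) * homog 1 x k)"
      using a by (intro zone_union_disj le less) auto
    then show ?thesis
    proof (rule zone_union_cong)
      fix x assume "x \<in> Rmax_vec n"
      then have "a * homog 1 x i \<in> Rmax" "homog 1 x k \<in> Rmax"
        using a ik by (auto intro!: Rmax_times homog_Rmax)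
      then show "a * homog 1 x i \<le> 0 * homog 1 x k \<or> a * homog 1 x i < Plain (ereal \<beta>) * homog 1 x k \<longleftrightarrow>
          a * homog 1 x i \<le> b * homog 1 x k"
        unfolding Minus by (subst le_Minus_iff) simp_all
    qed
  next
    case MInf
    then have "b \<in> Rmax"
      by (simp add: Rmax_iff zero_G_def)
    then show ?thesis
      using a by (intro le)
  next
    case (Real \<beta>)
    then show ?thesis
      using a by (intro le) simp_all
  qed
qed

lemma polyhedron_zone_union:
  assumes "mixed_tropical_polyhedron n P"
  shows "\<exists>F. finite F \<and> (\<forall>Z\<in>F. zone n Z) \<and> P = \<Union>F"
proof -
  obtain S where S: "finite S" "S \<subseteq> mixed_ineqs n" and P: "P = {x \<in> Rmax_vec n. \<forall>c\<in>S. satisfies x c}"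
    using assms unfolding mixed_tropical_polyhedron_def by blast
  have "zone_union n (\<lambda>x. satisfies x c)" if "c \<in> S" for c
  proof -
    obtain a0 a b0 b where c: "c = (a0, a, b0, b)"
      by (cases c)
    have "a0 \<in> Rmax" "a \<in> Rmax_vec n"
      using that S(2) c by (auto simp: mixed_ineqs_def)
    then have "zone_union n (\<lambda>x. \<forall>i\<in>{..n}. \<exists>k\<in>{..n}. homog a0 a i * homog 1 x i \<le> homog b0 b k * homog 1 x k)"
      by (intro zone_union_Ball zone_union_Bex zone_union_le) (auto intro: homog_Rmax)
    then show ?thesis
    proof (rule zone_union_cong)
      fix x assume x: "x \<in> Rmax_vec n"
      \<comment> \<open>Index \<open>0\<close> is always present. Over an empty index set the sum
        would be \<open>0\<close>, and the value \<open>0\<close> would lie below it without lying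
        below any term.\<close>
      have nonempty: "{..n} \<noteq> {}"
        by auto
      show "(\<forall>i\<in>{..n}. \<exists>k\<in>{..n}. homog a0 a i * homog 1 x i \<le> homog b0 b k * homog 1 x k) \<longleftrightarrow>
          satisfies x c"
        unfolding c satisfies_iff_sum[OF x] sum_G_le_iff[OF finite_atMost]
        by (simp only: le_sum_G_iff[OF finite_atMost nonempty])
    qed
  qed
  then have "zone_union n (\<lambda>x. \<forall>c\<in>S. satisfies x c)"
    using S(1) by (intro zone_union_Ball)
  then show ?thesis
    unfolding zone_union_def P .
qed


section \<open>Cones over zones and over tropically convex sets\<close>

text \<open>The origin is adjoined separately, so it belongs to the cone even over the empty set.
  Only the coordinates up to \<open>n\<close> are constrained.\<close>

definition in_cone :: "nat \<Rightarrow> G vec set \<Rightarrow> (nat \<Rightarrow> G) \<Rightarrow> bool" where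
  "in_cone n Z y \<longleftrightarrow>
    (\<forall>i\<le>n. y i = 0) \<or> (\<exists>x\<in>Z. \<exists>l\<in>Rmax. l \<noteq> 0 \<and> (\<forall>i\<le>n. y i = l * homog 1 x i))"

lemma in_cone_mono: "in_cone n Z y \<Longrightarrow> Z \<subseteq> P \<Longrightarrow> in_cone n P y"
  unfolding in_cone_def by blast

lemma in_cone_homog: "x \<in> Z \<Longrightarrow> in_cone n Z (homog 1 x)"
  unfolding in_cone_def by (intro disjI2 bexI[of _ x] bexI[of _ 1]) simp_all

text \<open>Coordinate \<open>0\<close> forces the scalar to be \<open>1\<close>, so passing to the
  cone adds no new point at height \<open>1\<close>.\<close>

lemma in_cone_homogD:
  assumes "in_cone n P (homog 1 x)" "P \<subseteq> Rmax_vec n" "x \<in> Rmax_vec n"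
  shows "x \<in> P"
proof -
  have "homog 1 x 0 \<noteq> 0"
    by simp
  then obtain z l where z: "z \<in> P" and eq: "\<forall>i\<le>n. homog 1 x i = l * homog 1 z i"
    using assms(1) unfolding in_cone_def by blast
  have "l = 1"
    using eq[rule_format, of 0] by simp
  then have "x $ i = z $ i" if "i < n" for i
    using eq[rule_format, of "Suc i"] that by simp
  moreover have "z \<in> Rmax_vec n"
    using z assms(2) by blast
  ultimately have "x = z"
    using assms(3) by (intro eq_vecI) (auto simp: Rmax_vec_def)
  then show ?thesis
    using z by simp
qed

text \<open>Dividing by the larger scalar \<open>m\<close> turns the weights into
  \<open>k * l \<le> 1\<close> and \<open>1\<close>, whose sum is \<open>1\<close>; convexity then
  applies, and multiplying by \<open>m\<close> recovers \<open>w\<close>.\<close>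

lemma in_cone_add_aux:
  assumes P: "tropically_convex P" "P \<subseteq> Rmax_vec n" and xy: "x \<in> P" "y \<in> P"
    and lm: "l \<in> Rmax" "m \<in> Rmax" "m \<noteq> 0" "l \<le> m"
    and w: "\<forall>i\<le>n. w i = l * homog 1 x i + m * homog 1 y i"
  shows "in_cone n P w"
proof -
  obtain k where k: "k \<in> Rmax" "k * m = 1" "m * k = 1"
    using lm(2,3) by (rule Rmax_inverse)
  have "k * l \<le> 1"
    using times_G_left_mono[OF lm(4), of k] k by simp
  then have kl: "k * l + 1 = 1"
    by (simp add: plus_G_def max_absorb2)
  define z where "z = (k * l) \<cdot>\<^sub>v x + 1 \<cdot>\<^sub>v y"
  have "z \<in> P"
    using P(1)[unfolded tropically_convex_def, rule_format, OF xy, of "k * l" 1] kl k(1) lm(1)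
    by (simp add: z_def)
  moreover have "w i = m * homog 1 z i" if "i \<le> n" for i
  proof -
    have "homog 1 z i = k * l * homog 1 x i + 1 * homog 1 y i"
      unfolding z_def using xy P(2) kl that by (intro homog_convex_comb) auto
    then have "m * homog 1 z i = (m * k) * (l * homog 1 x i) + m * homog 1 y i"
      by (simp add: distrib_left mult.assoc)
    then show ?thesis
      using w that k(3) by simp
  qed
  ultimately show ?thesis
    using lm(2,3) unfolding in_cone_def by blast
qed

lemma in_cone_cong: "in_cone n P y \<Longrightarrow> \<forall>i\<le>n. w i = y i \<Longrightarrow> in_cone n P w"
  unfolding in_cone_def by auto

lemma in_cone_add:
  assumes P: "tropically_convex P" "P \<subseteq> Rmax_vec n" and yz: "in_cone n P y" "in_cone n P z"
    and w: "\<forall>i\<le>n. w i = y i + z i"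
  shows "in_cone n P w"
proof (cases "(\<forall>i\<le>n. y i = 0) \<or> (\<forall>i\<le>n. z i = 0)")
  case True
  then have "(\<forall>i\<le>n. w i = z i) \<or> (\<forall>i\<le>n. w i = y i)"
    using w by auto
  then show ?thesis
    using yz in_cone_cong by blast
next
  case False
  then obtain x l where x: "x \<in> P" "l \<in> Rmax" "l \<noteq> 0" "\<forall>i\<le>n. y i = l * homog 1 x i"
    using yz(1) unfolding in_cone_def by blast
  obtain x' m where x': "x' \<in> P" "m \<in> Rmax" "m \<noteq> 0" "\<forall>i\<le>n. z i = m * homog 1 x' i"
    using False yz(2) unfolding in_cone_def by blast
  show ?thesis
  proof (cases "l \<le> m")
    case True
    then show ?thesis
      using x x' w by (intro in_cone_add_aux[OF P, of x x' l m]) auto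
  next
    case False
    then show ?thesis
      using x x' w by (intro in_cone_add_aux[OF P, of x' x m l]) (auto simp: add.commute)
  qed
qed

section \<open>Homogeneous descriptions of cones over zones\<close>

text \<open>Once coordinate \<open>0\<close> of \<open>homog 1 x\<close> plays the constant
  \<open>1\<close>, lower bounds, upper bounds and differences have one common form.\<close>

lemma zone_ineq_normal_form:
  assumes "zone_ineq n q"
  obtains R p r s t where "R \<in> {(\<le>), (<)}" "p \<in> Rmax" "r \<in> Rmax" "s \<le> n" "t \<le> n"
    "q = (\<lambda>x. R (p * homog 1 x s) (r * homog 1 x t))"
  using assms
proof cases
  case (lower i m R)
  then show thesis
    by (intro that[of R m 1 0 "Suc i"]) auto
next
  case (upper i M R)
  then show thesis
    by (intro that[of R 1 M "Suc i" 0]) auto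
next
  case (diff i j k R)
  then show thesis
    by (intro that[of R 1 k "Suc i" "Suc j"]) auto
qed

text \<open>
  \<open>u \<le> 0\<^sup>- w\<close> alone would also allow \<open>u = w = -\<infinity>\<close>; the second inequality excludes
  \<open>w = -\<infinity>\<close>, with \<open>l\<close> in the role of the homogenising variable.
\<close>

lemma less_iff_mixed:
  assumes "u \<in> Rmax" "w \<in> Rmax" "l \<noteq> 0"
  shows "u < w \<longleftrightarrow> u \<le> Minus 0 * w \<and> l \<le> Plain \<infinity> * w"
proof (cases "w = 0")
  case True
  then show ?thesis
    using assms(3) by (simp add: not_less)
next
  case False
  have "Plain (ereal 0) * w = w"
    using mult_1[of w] by (simp add: one_G_def zero_ereal_def)
  then show ?thesis
    using False by (subst le_Minus_iff[OF assms(1,2)]) (auto simp: times_PInf_G)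
qed

text \<open>A nonzero scalar of \<open>Rmax\<close> cancels from both sides, so an inequality can be
  tested anywhere on the ray through \<open>homog 1 x\<close>. The origin must be accepted as well,
  because it belongs to every cone.\<close>

lemma zone_ineq_homogeneous:
  assumes "zone_ineq n q"
  shows "\<exists>\<psi>. mixed {..n} \<psi> \<and> \<psi> (\<lambda>i. 0) \<and>
    (\<forall>x\<in>Rmax_vec n. \<forall>l\<in>Rmax. l \<noteq> 0 \<longrightarrow> (\<psi> (\<lambda>i. l * homog 1 x i) \<longleftrightarrow> q x))"
proof -
  obtain R p r s t where R: "R \<in> {(\<le>), (<)}" and p: "p \<in> Rmax" and r: "r \<in> Rmax"
    and st: "s \<le> n" "t \<le> n" and q: "q = (\<lambda>x. R (p * homog 1 x s) (r * homog 1 x t))"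
    using assms by (rule zone_ineq_normal_form)
  have q_iff: "q x \<longleftrightarrow> R (p * (l * homog 1 x s)) (r * (l * homog 1 x t))"
    if "l \<in> Rmax" "l \<noteq> 0" for x l
    using times_G_cancel_rel[OF R that, of "p * homog 1 x s" "r * homog 1 x t"]
    by (simp add: q mult.left_commute)
  show ?thesis
  proof (cases "R = (\<le>)")
    case True
    have "mixed {..n} (\<lambda>y. p * y s \<le> r * y t)"
      using p st by (intro mixed_le) auto
    then show ?thesis
      using q_iff True by (intro exI[of _ "\<lambda>y. p * y s \<le> r * y t"]) auto
  next
    case False
    then have R: "R = (<)"
      using R by simp
    \<comment> \<open>On the ray, \<open>y 0\<close> is the scalar \<open>l\<close>. At the origin
      both conjuncts compare \<open>0\<close> with \<open>0\<close> and hold, although the strict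
      inequality itself fails there.\<close>
    let ?\<psi> = "\<lambda>y. p * y s \<le> (Minus 0 * r) * y t \<and> 1 * y 0 \<le> (Plain \<infinity> * r) * y t"
    have "mixed {..n} ?\<psi>"
      using p st by (intro mixed_conj mixed_le) auto
    moreover have "?\<psi> (\<lambda>i. l * homog 1 x i) \<longleftrightarrow> q x"
      if "x \<in> Rmax_vec n" "l \<in> Rmax" "l \<noteq> 0" for x l
    proof -
      have "p * (l * homog 1 x s) \<in> Rmax" "r * (l * homog 1 x t) \<in> Rmax"
        using p r that st by (auto intro!: Rmax_times homog_Rmax)
      then show ?thesis
        unfolding q_iff[OF that(2,3)] R using less_iff_mixed[OF _ _ that(3)]
        by (simp add: mult.assoc)
    qed
    ultimately show ?thesis
      by (intro exI[of _ ?\<psi>]) simp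
  qed
qed

text \<open>
  The inequalities \<open>y i \<le> (+\<infinity>) (y 0)\<close> remove the recession directions (the points
  with \<open>y 0 = -\<infinity>\<close>), so that no closure is taken.
\<close>

lemma mixed_cone_zone:
  assumes "zone n Z"
  shows "mixed {..n} (in_cone n Z)"
proof -
  obtain Q where Q: "finite Q" "\<forall>q\<in>Q. zone_ineq n q" and Z: "Z = {x \<in> Rmax_vec n. \<forall>q\<in>Q. q x}"
    using assms unfolding zone_def by blast
  have "\<forall>q\<in>Q. \<exists>\<psi>. mixed {..n} \<psi> \<and> \<psi> (\<lambda>i. 0) \<and>
    (\<forall>x\<in>Rmax_vec n. \<forall>l\<in>Rmax. l \<noteq> 0 \<longrightarrow> (\<psi> (\<lambda>i. l * homog 1 x i) \<longleftrightarrow> q x))"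
    using Q(2) zone_ineq_homogeneous by blast
  from bchoice[OF this] obtain \<psi> where \<psi>: "\<And>q. q \<in> Q \<Longrightarrow> mixed {..n} (\<psi> q)"
    "\<And>q. q \<in> Q \<Longrightarrow> \<psi> q (\<lambda>i. 0)"
    "\<And>q x l. q \<in> Q \<Longrightarrow> x \<in> Rmax_vec n \<Longrightarrow> l \<in> Rmax \<Longrightarrow> l \<noteq> 0 \<Longrightarrow>
      \<psi> q (\<lambda>i. l * homog 1 x i) \<longleftrightarrow> q x"
    by blast
  have "mixed {..n} (\<lambda>y. (\<forall>i\<in>{..n}. 1 * y i \<le> Plain \<infinity> * y 0) \<and> (\<forall>q\<in>Q. \<psi> q y))"
    using Q(1) \<psi>(1) by (intro mixed_conj mixed_Ball mixed_le) auto
  then show ?thesis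
  proof (rule mixed_cong)
    fix y :: "nat \<Rightarrow> G"
    assume "\<And>i. i \<in> {..n} \<Longrightarrow> y i \<in> Rmax"
    then have y: "y i \<in> Rmax" if "i \<le> n" for i
      using that by simp
    \<comment> \<open>The properties of \<open>\<psi>\<close> concern functions given on all of
      \<open>nat\<close>, whereas \<open>y\<close> is known to agree with such a function only up to
      \<open>n\<close>.\<close>
    have cong: "\<psi> q y \<longleftrightarrow> \<psi> q y'" if "q \<in> Q" "\<And>i. i \<le> n \<Longrightarrow> y i = y' i" for q y'
      using that y by (intro mixed_env_cong[OF \<psi>(1)]) auto
    show "(\<forall>i\<in>{..n}. 1 * y i \<le> Plain \<infinity> * y 0) \<and> (\<forall>q\<in>Q. \<psi> q y) \<longleftrightarrow> in_cone n Z y"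
    proof (cases "y 0 = 0")
      case True
      have "in_cone n Z y \<longleftrightarrow> (\<forall>i\<le>n. y i = 0)"
      proof -
        have "l = 0" if "\<forall>i\<le>n. y i = l * homog 1 x i" for l x
          using that[rule_format, of 0] True by simp
        then show ?thesis
          unfolding in_cone_def by blast
      qed
      moreover have "\<psi> q y" if "q \<in> Q" "\<forall>i\<le>n. y i = 0" for q
        using cong[OF that(1), of "\<lambda>i. 0"] \<psi>(2) that by simp
      ultimately show ?thesis
        using True by auto
    next
      case False
      have y0: "y 0 \<in> Rmax"
        using y by simp
      obtain k where k: "k \<in> Rmax" "y 0 * k = 1"
        using y0 False by (rule Rmax_inverse)
      \<comment> \<open>Since \<open>k\<close> inverts \<open>y 0\<close>, this \<open>x\<close> is
        the only vector of dimension \<open>n\<close> whose ray can pass through \<open>y\<close>;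
        membership of \<open>y\<close> in the cone thus reduces to \<open>x \<in> Z\<close>.\<close>
      define x where "x = vec n (\<lambda>i. k * y (Suc i))"
      have x: "x \<in> Rmax_vec n"
        using k y by (auto simp: x_def Rmax_vec_def)
      have y_eq: "y i = y 0 * homog 1 x i" if "i \<le> n" for i
        using that k(2) by (cases i) (simp_all add: x_def flip: mult.assoc)
      have "\<psi> q y \<longleftrightarrow> q x" if "q \<in> Q" for q
        using cong[OF that y_eq] \<psi>(3)[OF that x y0 False] by simp
      then have "(\<forall>i\<in>{..n}. 1 * y i \<le> Plain \<infinity> * y 0) \<and> (\<forall>q\<in>Q. \<psi> q y) \<longleftrightarrow> x \<in> Z"
        using False x by (simp add: Z times_PInf_G)
      also have "\<dots> \<longleftrightarrow> in_cone n Z y"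
      proof
        assume "x \<in> Z"
        then show "in_cone n Z y"
          unfolding in_cone_def using y_eq y0 False by blast
      next
        assume "in_cone n Z y"
        then obtain z l where z: "z \<in> Z" "l \<in> Rmax" and eq: "\<forall>i\<le>n. y i = l * homog 1 z i"
          using False unfolding in_cone_def by blast
        have "l = y 0"
          using eq by simp
        have "homog 1 x i = homog 1 z i" if "i \<le> n" for i
        proof -
          have "y 0 * homog 1 x i = y 0 * homog 1 z i"
            using eq y_eq that \<open>l = y 0\<close> by metis
          then show ?thesis
            using times_G_cancel_le[OF y0 False] by (metis antisym order_refl)
        qed
        then have "in_cone n Z (homog 1 x)"
          by (intro in_cone_cong[OF in_cone_homog[OF z(1)]]) blast
        then show "x \<in> Z"
          by (rule in_cone_homogD) (use x in \<open>auto simp: Z\<close>)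
      qed
      finally show ?thesis .
    qed
  qed
qed

section \<open>Sums of cones and the equivalence\<close>

text \<open>The sum of the cones is recorded through two bounds: it lies in the cone over
  \<open>P\<close> and contains the cone over each \<open>Z\<close>. Membership of the origin is the
  invariant behind the second bound, since it lets a point of one cone be written as itself plus the
  origin.\<close>

lemma mixed_sum_of_cones:
  assumes P: "tropically_convex P" "P \<subseteq> Rmax_vec n"
    and F: "finite F" "\<forall>Z\<in>F. zone n Z" "\<forall>Z\<in>F. Z \<subseteq> P"
  obtains \<phi> where "mixed {..n} \<phi>"
    "\<forall>y. (\<forall>i\<in>{..n}. y i \<in> Rmax) \<longrightarrow> \<phi> y \<longrightarrow> in_cone n P y"
    "\<phi> (\<lambda>i. 0)"
    "\<forall>y. \<forall>Z\<in>F. (\<forall>i\<in>{..n}. y i \<in> Rmax) \<longrightarrow> in_cone n Z y \<longrightarrow> \<phi> y"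
  using F
proof (induction F arbitrary: thesis rule: finite_induct)
  case empty
  \<comment> \<open>This defines the origin alone, the neutral element for sums of cones.\<close>
  let ?\<phi> = "\<lambda>y. \<forall>i\<in>{..n}. 1 * y i \<le> 0 * y 0"
  show ?case
  proof (rule empty.prems(1)[of ?\<phi>])
    show "mixed {..n} ?\<phi>"
      by (intro mixed_Ball mixed_le) auto
    show "\<forall>y. (\<forall>i\<in>{..n}. y i \<in> Rmax) \<longrightarrow> ?\<phi> y \<longrightarrow> in_cone n P y"
      by (simp add: in_cone_def)
  qed auto
next
  case (insert Z F)
  have F: "\<forall>Z\<in>F. zone n Z" "\<forall>Z\<in>F. Z \<subseteq> P" and Z: "zone n Z" "Z \<subseteq> P"
    using insert.prems(2,3) by simp_all
  obtain \<phi> where \<phi>: "mixed {..n} \<phi>"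
    "\<forall>y. (\<forall>i\<in>{..n}. y i \<in> Rmax) \<longrightarrow> \<phi> y \<longrightarrow> in_cone n P y"
    "\<phi> (\<lambda>i. 0)"
    "\<forall>y. \<forall>Z\<in>F. (\<forall>i\<in>{..n}. y i \<in> Rmax) \<longrightarrow> in_cone n Z y \<longrightarrow> \<phi> y"
    by (rule insert.IH[OF _ F])
  have zero: "in_cone n Z (\<lambda>i. 0)"
    by (simp add: in_cone_def)
  let ?\<phi> = "cone_sum {..n} (in_cone n Z) \<phi>"
  show ?case
  proof (rule insert.prems(1)[of ?\<phi>])
    show "mixed {..n} ?\<phi>"
      using mixed_cone_zone[OF Z(1)] \<phi>(1) by (intro mixed_cone_sum) simp_all
    show "\<forall>y. (\<forall>i\<in>{..n}. y i \<in> Rmax) \<longrightarrow> ?\<phi> y \<longrightarrow> in_cone n P y"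
    proof (intro allI impI)
      fix y assume y: "?\<phi> y"
      obtain u v where v: "\<forall>i\<in>{..n}. v i \<in> Rmax" and uv: "in_cone n Z u" "\<phi> v"
        and eq: "\<forall>i\<in>{..n}. y i = u i + v i"
        using y unfolding cone_sum_def by blast
      have "in_cone n P u"
        using uv(1) Z(2) by (rule in_cone_mono)
      moreover have "in_cone n P v"
        using \<phi>(2) v uv(2) by blast
      ultimately show "in_cone n P y"
        by (rule in_cone_add[OF P]) (use eq in simp)
    qed
    show "?\<phi> (\<lambda>i. 0)"
      unfolding cone_sum_def using zero \<phi>(3)
      by (intro exI[of _ "\<lambda>i. 0"]) simp
    show "\<forall>y. \<forall>Z\<in>insert Z F. (\<forall>i\<in>{..n}. y i \<in> Rmax) \<longrightarrow> in_cone n Z y \<longrightarrow> ?\<phi> y"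
    proof (intro allI ballI impI)
      fix y Z'
      assume y: "\<forall>i\<in>{..n}. y i \<in> Rmax" and Z': "Z' \<in> insert Z F" "in_cone n Z' y"
      show "?\<phi> y"
      proof (cases "Z' = Z")
        case True
        then show ?thesis
          unfolding cone_sum_def using y Z'(2) \<phi>(3)
          by - (rule exI[of _ y], rule exI[of _ "\<lambda>i. 0"], simp)
      next
        case False
        then have "\<phi> y"
          using \<phi>(4) y Z' by blast
        then show ?thesis
          unfolding cone_sum_def using y zero
            by - (rule exI[of _ "\<lambda>i. 0"], rule exI[of _ y], simp)
      qed
    qed
  qed
qed

lemma convex_zone_union_polyhedron:
  assumes P: "tropically_convex P" "P \<subseteq> Rmax_vec n"
    and F: "finite F" "\<forall>Z\<in>F. zone n Z" "P = \<Union>F"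
  shows "mixed_tropical_polyhedron n P"
proof -
  have "\<forall>Z\<in>F. Z \<subseteq> P"
    using F(3) by blast
  then obtain \<phi> where \<phi>: "mixed {..n} \<phi>"
    "\<forall>y. (\<forall>i\<in>{..n}. y i \<in> Rmax) \<longrightarrow> \<phi> y \<longrightarrow> in_cone n P y"
    "\<phi> (\<lambda>i. 0)"
    "\<forall>y. \<forall>Z\<in>F. (\<forall>i\<in>{..n}. y i \<in> Rmax) \<longrightarrow> in_cone n Z y \<longrightarrow> \<phi> y"
    by (rule mixed_sum_of_cones[OF P F(1,2)])
  have "x \<in> P \<longleftrightarrow> \<phi> (homog 1 x)" if x: "x \<in> Rmax_vec n" for x
  proof -
    have R: "\<forall>i\<in>{..n}. homog 1 x i \<in> Rmax"
      using x by (auto intro: homog_Rmax)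
    show ?thesis
    proof
      assume "x \<in> P"
      then obtain Z where "Z \<in> F" "x \<in> Z"
        using F(3) by blast
      moreover from \<open>x \<in> Z\<close> have "in_cone n Z (homog 1 x)"
        by (rule in_cone_homog)
      ultimately show "\<phi> (homog 1 x)"
        using \<phi>(4) R by blast
    next
      assume "\<phi> (homog 1 x)"
      then have "in_cone n P (homog 1 x)"
        using \<phi>(2) R by blast
      then show "x \<in> P"
        using P(2) x by (rule in_cone_homogD)
    qed
  qed
  then have "P = {x \<in> Rmax_vec n. \<phi> (homog 1 x)}"
    using P(2) by auto
  then show ?thesis
    by (rule mixed_imp_polyhedron[OF \<phi>(1)])
qed

theorem theorem13:
  fixes n :: nat and P :: "G vec set"
  assumes "P \<subseteq> Rmax_vec n"
  shows "mixed_tropical_polyhedron n P \<longleftrightarrow>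
    tropically_convex P \<and> (\<exists>F. finite F \<and> (\<forall>Z\<in>F. zone n Z) \<and> P = \<Union>F)"
proof
  assume "mixed_tropical_polyhedron n P"
  then show "tropically_convex P \<and> (\<exists>F. finite F \<and> (\<forall>Z\<in>F. zone n Z) \<and> P = \<Union>F)"
    by (intro conjI polyhedron_convex polyhedron_zone_union)
next
  assume R: "tropically_convex P \<and> (\<exists>F. finite F \<and> (\<forall>Z\<in>F. zone n Z) \<and> P = \<Union>F)"
  then obtain F where "finite F" "\<forall>Z\<in>F. zone n Z" "P = \<Union>F"
    by (elim conjE exE)
  then show "mixed_tropical_polyhedron n P"
    using R assms by (intro convex_zone_union_polyhedron) simp_all
qed

end
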